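(* Let $n\in\mathbf{N}$, $K\in\mathbf{R}$ and $d>0$. Then \[h(X)\le p\left(\lambda_{1,p}(X)\right)^{1/p}\] holds for every $1<p<\infty$ and every $(X,\upsilon)\in\overline{M(n,K,d)}$.
   Context: A compact metric measure space $(X,\upsilon)$ is a compact metric space $X$ (distance denoted $\overline{x,y}$) with a Borel probability measure $\upsilon$. For a Lipschitz function $f$ on $X$, $\mathrm{Lip}f(x):=\lim_{r\to0}\sup_{y\in B_r(x)\setminus\{x\}}|f(x)-f(y)|/\overline{x,y}$ if $x$ is not isolated, and $\mathrm{Lip}f(x):=0$ otherwise. For Borel $A\subset X$ let $\upsilon^+(A):=\liminf_{r\to0}\frac{\upsilon(B_r(A))-\upsilon(A)}{r}$, where $B_r(A)$ is the open $r$-neighborhood of $A$; the Cheeger constant is $h(X):=\inf_A\upsilon^+(A)/\upsilon(A)$ over Borel $A$ with $0<\upsilon(A)\le1/2$ ($h(X):=\infty$ if there is no such $A$). For $1<p<\infty$, $\lambda_{1,p}(X):=\inf_f\int_X(\mathrm{Lip}f)^p\,d\upsilon$ over Lipschitz functions $f$ on $X$ with $\int_X|f|^p\,d\upsilon=1$ and $\int_X|f|^{p-2}f\,d\upsilon=0$ ($:=\infty$ if there is no such $f$, i.e. if $X$ is a single point). $M(n,K,d)$ is the set of isometry classes of pairs $(M,\mathrm{Vol})$ where $M$ is an $n$-dimensional (connected) compact Riemannian manifold with $\mathrm{diam}\,M\le d$ and $\mathrm{Ric}_M\ge K(n-1)$, and $\mathrm{Vol}$ is the Riemannian volume normalized to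 total mass $1$. $\overline{M(n,K,d)}$ consists of all compact metric measure spaces that are measured Gromov-Hausdorff limits of sequences in $M(n,K,d)$. Here $(X_i,\upsilon_i)\to(X_\infty,\upsilon_\infty)$ means that there are Borel maps $\phi_i:X_i\to X_\infty$ and $\epsilon_i\searrow0$ such that $X_\infty=B_{\epsilon_i}(\phi_i(X_i))$, $|\overline{x,y}-\overline{\phi_i(x),\phi_i(y)}|<\epsilon_i$ for all $x,y\in X_i$, and $(\phi_i)_*\upsilon_i\to\upsilon_\infty$ weakly. *)

theory Defs
  imports "HOL-Probability.Probability"
begin

section \<open>Metric measure spaces\<close>

text \<open>A metric measure space is a pair of a \<open>metric\<close> (carrier set and distance) and a \<open>measure\<close>.\<close>

definition borel_sigma :: "'a topology \<Rightarrow> 'a measure" where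
  "borel_sigma T = sigma (topspace T) {U. openin T U}"

definition compact_mm_space :: "'a metric \<times> 'a measure \<Rightarrow> bool" where
  "compact_mm_space = (\<lambda>(X, \<upsilon>).
     compact_space (mtopology_of X) \<and>
     sets \<upsilon> = sets (borel_sigma (mtopology_of X)) \<and>
     prob_space \<upsilon>)"

definition open_nbhd :: "'a metric \<Rightarrow> real \<Rightarrow> 'a set \<Rightarrow> 'a set" where
  "open_nbhd X r A = {x \<in> mspace X. \<exists>a\<in>A. mdist X x a < r}"

definition Lip :: "'a metric \<Rightarrow> ('a \<Rightarrow> real) \<Rightarrow> 'a \<Rightarrow> real" where
  "Lip X f x =
     (if openin (mtopology_of X) {x} then 0
      else Lim (at_right 0) (\<lambda>r. SUP y \<in> mball_of X x r - {x}. \<bar>f x - f y\<bar> / mdist X x y))"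

definition boundary_measure :: "'a metric \<times> 'a measure \<Rightarrow> 'a set \<Rightarrow> ennreal" where
  "boundary_measure = (\<lambda>(X, \<upsilon>) A.
     Liminf (at_right 0)
       (\<lambda>r. (emeasure \<upsilon> (open_nbhd X r A) - emeasure \<upsilon> A) / ennreal r))"

text \<open>In \<open>ennreal\<close>, the infimum of the empty set is \<open>\<infinity>\<close>, as the conventions for the two
  constants below require.\<close>

definition cheeger_const :: "'a metric \<times> 'a measure \<Rightarrow> ennreal" where
  "cheeger_const = (\<lambda>(X, \<upsilon>).
     INF A \<in> {A \<in> sets \<upsilon>. 0 < emeasure \<upsilon> A \<and> emeasure \<upsilon> A \<le> 1 / 2}.
       boundary_measure (X, \<upsilon>) A / emeasure \<upsilon> A)"

definition lambda1 :: "real \<Rightarrow> 'a metric \<times> 'a measure \<Rightarrow> ennreal" where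
  "lambda1 p = (\<lambda>(X, \<upsilon>).
     INF f \<in> {f. Lipschitz_continuous_map X euclidean_metric f \<and>
                 (\<integral>x. \<bar>f x\<bar> powr p \<partial>\<upsilon>) = 1 \<and>
                 (\<integral>x. \<bar>f x\<bar> powr (p - 2) * f x \<partial>\<upsilon>) = 0}.
       (\<integral>\<^sup>+ x. ennreal (Lip X f x powr p) \<partial>\<upsilon>))"

text \<open>Only meant for positive exponents.\<close>

definition ennreal_powr :: "ennreal \<Rightarrow> real \<Rightarrow> ennreal" where
  "ennreal_powr x a = (if x = \<infinity> then \<infinity> else ennreal (enn2real x powr a))"


section \<open>Measured Gromov-Hausdorff convergence\<close>

text \<open>Continuous functions on a compact limit space are automatically bounded, so these are the
  usual test functions for weak convergence.\<close>

definition mGH_converges ::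
    "(nat \<Rightarrow> 'm metric \<times> 'm measure) \<Rightarrow> 'a metric \<times> 'a measure \<Rightarrow> bool" where
  "mGH_converges Xs = (\<lambda>(X, \<upsilon>).
     \<exists>(\<phi> :: nat \<Rightarrow> 'm \<Rightarrow> 'a) (\<epsilon> :: nat \<Rightarrow> real).
       (\<forall>i. \<phi> i \<in> snd (Xs i) \<rightarrow>\<^sub>M \<upsilon>) \<and>
       (\<forall>i. 0 < \<epsilon> i) \<and> decseq \<epsilon> \<and> \<epsilon> \<longlonglongrightarrow> 0 \<and>
       (\<forall>i. mspace X = open_nbhd X (\<epsilon> i) (\<phi> i ` mspace (fst (Xs i)))) \<and>
       (\<forall>i. \<forall>x \<in> mspace (fst (Xs i)). \<forall>y \<in> mspace (fst (Xs i)).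
          \<bar>mdist (fst (Xs i)) x y - mdist X (\<phi> i x) (\<phi> i y)\<bar> < \<epsilon> i) \<and>
       (\<forall>f. continuous_map (mtopology_of X) euclideanreal f \<longrightarrow>
          (\<lambda>i. \<integral>x. f x \<partial>(distr (snd (Xs i)) \<upsilon> (\<phi> i))) \<longlonglongrightarrow> (\<integral>x. f x \<partial>\<upsilon>)))"

definition mGH_limits :: "('m metric \<times> 'm measure) set \<Rightarrow> ('a metric \<times> 'a measure) set" where
  "mGH_limits \<C> =
     {X. compact_mm_space X \<and> (\<exists>Xs. (\<forall>i. Xs i \<in> \<C>) \<and> mGH_converges Xs X)}"


section \<open>Smooth functions on open subsets of Euclidean space\<close>

definition partial_deriv :: "'n \<Rightarrow> (real^'n \<Rightarrow> real) \<Rightarrow> real^'n \<Rightarrow> real" where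
  "partial_deriv i f x = deriv (\<lambda>t. f (x + t *\<^sub>R axis i 1)) 0"

primrec Ck_on :: "nat \<Rightarrow> (real^'n) set \<Rightarrow> (real^'n \<Rightarrow> real) \<Rightarrow> bool" where
  "Ck_on 0 S f \<longleftrightarrow> continuous_on S f"
| "Ck_on (Suc k) S f \<longleftrightarrow>
     continuous_on S f \<and>
     (\<forall>i. (\<forall>x\<in>S. (\<lambda>t::real. f (x + t *\<^sub>R axis i 1)) differentiable (at 0)) \<and>
          Ck_on k S (partial_deriv i f))"

definition smooth_on :: "(real^'n) set \<Rightarrow> (real^'n \<Rightarrow> real) \<Rightarrow> bool" where
  "smooth_on S f \<longleftrightarrow> (\<forall>k. Ck_on k S f)"


section \<open>Riemannian manifolds\<close>

text \<open>A chart is a pair of its domain and its coordinate map.  The atlas need not be maximal.  The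
  Riemannian metric is given by its coefficient matrices \<open>rm_metric M c\<close> in each chart \<open>c\<close> of the
  atlas, as functions of the coordinates; the charts are related by the tensor transformation rule.
  The dimension is \<open>CARD('n)\<close>.\<close>

record ('m, 'n) riem =
  rm_top :: "'m topology"
  rm_atlas :: "('m set \<times> ('m \<Rightarrow> real^'n)) set"
  rm_metric :: "'m set \<times> ('m \<Rightarrow> real^'n) \<Rightarrow> real^'n \<Rightarrow> real^'n^'n"

definition chart_on :: "'m topology \<Rightarrow> 'm set \<times> ('m \<Rightarrow> real^'n) \<Rightarrow> bool" where
  "chart_on T = (\<lambda>(U, \<phi>).
     openin T U \<and> open (\<phi> ` U) \<and>
     homeomorphic_map (subtopology T U) (top_of_set (\<phi> ` U)) \<phi>)"

definition transition ::
    "'m set \<times> ('m \<Rightarrow> real^'n) \<Rightarrow> 'm set \<times> ('m \<Rightarrow> real^'n) \<Rightarrow> real^'n \<Rightarrow> real^'n" where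
  "transition = (\<lambda>(U, \<phi>) (V, \<psi>) x. \<psi> (inv_into U \<phi> x))"

definition smooth_atlas :: "'m topology \<Rightarrow> ('m set \<times> ('m \<Rightarrow> real^'n)) set \<Rightarrow> bool" where
  "smooth_atlas T \<A> \<longleftrightarrow>
     (\<forall>c\<in>\<A>. chart_on T c) \<and>
     (\<Union>c\<in>\<A>. fst c) = topspace T \<and>
     (\<forall>c\<in>\<A>. \<forall>c'\<in>\<A>. \<forall>i.
        smooth_on (snd c ` (fst c \<inter> fst c')) (\<lambda>x. transition c c' x $ i))"

definition riemannian_manifold :: "('m, 'n::finite) riem \<Rightarrow> bool" where
  "riemannian_manifold M \<longleftrightarrow>
     Hausdorff_space (rm_top M) \<and> second_countable (rm_top M) \<and>
     smooth_atlas (rm_top M) (rm_atlas M) \<and>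
     (\<forall>c \<in> rm_atlas M.
        (\<forall>i j. smooth_on (snd c ` fst c) (\<lambda>x. rm_metric M c x $ i $ j)) \<and>
        (\<forall>x \<in> snd c ` fst c.
           transpose (rm_metric M c x) = rm_metric M c x \<and>
           (\<forall>v. v \<noteq> 0 \<longrightarrow> v \<bullet> (rm_metric M c x *v v) > 0))) \<and>
     (\<forall>c \<in> rm_atlas M. \<forall>c' \<in> rm_atlas M. \<forall>x \<in> snd c ` (fst c \<inter> fst c').
        let J = jacobian (transition c c') (at x)
        in rm_metric M c x = transpose J ** rm_metric M c' (transition c c' x) ** J)"


subsection \<open>Distance\<close>

definition C1_curve_on :: "('m, 'n::finite) riem \<Rightarrow> real \<Rightarrow> real \<Rightarrow> (real \<Rightarrow> 'm) \<Rightarrow> bool" where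
  "C1_curve_on M a b \<gamma> \<longleftrightarrow>
     continuous_map (top_of_set {a..b}) (rm_top M) \<gamma> \<and>
     (\<forall>c \<in> rm_atlas M. \<exists>D.
        continuous_on {t \<in> {a..b}. \<gamma> t \<in> fst c} D \<and>
        (\<forall>t \<in> {a..b}. \<gamma> t \<in> fst c \<longrightarrow>
           ((\<lambda>s. snd c (\<gamma> s)) has_vector_derivative D t) (at t within {a..b})))"

definition piecewise_C1_curve :: "('m, 'n::finite) riem \<Rightarrow> (real \<Rightarrow> 'm) \<Rightarrow> bool" where
  "piecewise_C1_curve M \<gamma> \<longleftrightarrow>
     continuous_map (top_of_set {0..1}) (rm_top M) \<gamma> \<and>
     (\<exists>S. finite S \<and>
        (\<forall>a b. 0 \<le> a \<and> a < b \<and> b \<le> 1 \<and> {a<..<b} \<inter> S = {} \<longrightarrow> C1_curve_on M a b \<gamma>))"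

text \<open>The speed does not depend on the chosen chart, by the transformation rule.\<close>

definition speed :: "('m, 'n::finite) riem \<Rightarrow> (real \<Rightarrow> 'm) \<Rightarrow> real \<Rightarrow> real" where
  "speed M \<gamma> t =
     (let c = (SOME c. c \<in> rm_atlas M \<and> \<gamma> t \<in> fst c);
          v = vector_derivative (\<lambda>s. snd c (\<gamma> s)) (at t)
      in sqrt (v \<bullet> (rm_metric M c (snd c (\<gamma> t)) *v v)))"

definition curve_length :: "('m, 'n::finite) riem \<Rightarrow> (real \<Rightarrow> 'm) \<Rightarrow> real" where
  "curve_length M \<gamma> = integral {0..1} (speed M \<gamma>)"

definition riem_dist :: "('m, 'n::finite) riem \<Rightarrow> 'm \<Rightarrow> 'm \<Rightarrow> real" where
  "riem_dist M x y =
     Inf {curve_length M \<gamma> | \<gamma>. piecewise_C1_curve M \<gamma> \<and> \<gamma> 0 = x \<and> \<gamma> 1 = y}"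


subsection \<open>Volume\<close>

definition riem_volume :: "('m, 'n::finite) riem \<Rightarrow> 'm measure \<Rightarrow> bool" where
  "riem_volume M \<mu> \<longleftrightarrow>
     sets \<mu> = sets (borel_sigma (rm_top M)) \<and>
     (\<forall>c \<in> rm_atlas M. \<forall>A \<in> sets \<mu>. A \<subseteq> fst c \<longrightarrow>
        emeasure \<mu> A =
          (\<integral>\<^sup>+ x \<in> snd c ` A. ennreal (sqrt (det (rm_metric M c x))) \<partial>lborel))"

definition normalized_riem_volume :: "('m, 'n::finite) riem \<Rightarrow> 'm measure \<Rightarrow> bool" where
  "normalized_riem_volume M \<upsilon> \<longleftrightarrow>
     (\<exists>\<mu>. riem_volume M \<mu> \<and> \<upsilon> = scale_measure (inverse (emeasure \<mu> (space \<mu>))) \<mu>)"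


subsection \<open>Ricci curvature\<close>

text \<open>For a coefficient matrix \<open>g\<close> as a function of the coordinates, \<open>christoffel g k i j\<close> is
  $\Gamma^k_{ij}$, and the sign of \<open>ricci\<close> is the one for which round spheres are positively
  curved.\<close>

definition christoffel ::
    "(real^'n \<Rightarrow> real^'n^'n) \<Rightarrow> 'n \<Rightarrow> 'n \<Rightarrow> 'n \<Rightarrow> real^'n \<Rightarrow> real" where
  "christoffel g k i j x =
     (\<Sum>l\<in>UNIV. matrix_inv (g x) $ k $ l *
        (partial_deriv i (\<lambda>y. g y $ j $ l) x + partial_deriv j (\<lambda>y. g y $ i $ l) x
         - partial_deriv l (\<lambda>y. g y $ i $ j) x)) / 2"

definition ricci :: "(real^'n \<Rightarrow> real^'n^'n) \<Rightarrow> real^'n \<Rightarrow> real^'n^'n" where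
  "ricci g x = (\<chi> i j.
     (\<Sum>k\<in>UNIV. partial_deriv k (christoffel g k i j) x - partial_deriv j (christoffel g k i k) x)
     + (\<Sum>k\<in>UNIV. \<Sum>l\<in>UNIV.
          christoffel g k k l x * christoffel g l i j x
          - christoffel g k j l x * christoffel g l i k x))"

definition ricci_ge :: "('m, 'n::finite) riem \<Rightarrow> real \<Rightarrow> bool" where
  "ricci_ge M \<kappa> \<longleftrightarrow>
     (\<forall>c \<in> rm_atlas M. \<forall>x \<in> snd c ` fst c. \<forall>v.
        v \<bullet> (ricci (rm_metric M c) x *v v) \<ge> \<kappa> * (v \<bullet> (rm_metric M c x *v v)))"


section \<open>The class of manifolds with bounded diameter and Ricci curvature bounded below\<close>

text \<open>Instead of isometry classes we take all representatives with points in \<open>'m\<close>.  The dimension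
  \<open>n\<close> is \<open>CARD('n)\<close>.\<close>

definition ricci_class :: "'n::finite itself \<Rightarrow> real \<Rightarrow> real \<Rightarrow> ('m metric \<times> 'm measure) set" where
  "ricci_class _ K d =
     {(X, \<upsilon>). \<exists>M :: ('m, 'n) riem.
        riemannian_manifold M \<and>
        topspace (rm_top M) \<noteq> {} \<and> compact_space (rm_top M) \<and> connected_space (rm_top M) \<and>
        mspace X = topspace (rm_top M) \<and>
        (\<forall>x \<in> mspace X. \<forall>y \<in> mspace X. mdist X x y = riem_dist M x y) \<and>
        (\<forall>x \<in> mspace X. \<forall>y \<in> mspace X. mdist X x y \<le> d) \<and>
        ricci_ge M (K * (real CARD('n) - 1)) \<and>
        normalized_riem_volume M \<upsilon>}"

end

theory Submission
  imports Defs
begin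

text \<open>Cheeger's argument works on every compact metric measure space.  For a bounded continuous
  \<open>w \<ge> 0\<close>, the \<open>r\<close>-neighbourhood of \<open>{w > t}\<close> is \<open>{w\<^sub>r > t}\<close>, where \<open>w\<^sub>r x\<close> is the supremum
  of \<open>w\<close> over the \<open>r\<close>-ball around \<open>x\<close>.  Tonelli's theorem and Fatou's lemma then give the coarea
  inequality: if \<open>{w > 0}\<close> has measure at most \<open>1/2\<close>, the Cheeger constant \<open>h\<close> times the integral
  of \<open>w\<close> is at most the lower limit of the integrals of \<open>(w\<^sub>r - w) / r\<close>.  Apply this to the
  \<open>p\<close>-th powers of the positive and negative parts of \<open>f - m\<close>, where \<open>m\<close> is a median of \<open>f\<close>; the
  quotients are asymptotically at most \<open>p \<bar>f - m\<bar>\<^bsup>p-1\<^esup> Lip f\<close>.  Young's inequality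
  \<open>p a\<^bsup>p-1\<^esup> b \<le> (p - 1) \<tau> a\<^bsup>p\<^esup> + \<tau>\<^bsup>1-p\<^esup> b\<^bsup>p\<^esup>\<close>, with \<open>\<tau>\<^bsup>p\<^esup>\<close> just above the integral of
  \<open>(Lip f)\<^bsup>p\<^esup>\<close>, bounds \<open>h I\<close> by \<open>(p - 1) \<tau> I + \<tau>\<close>, where \<open>I\<close> is the integral of
  \<open>\<bar>f - m\<bar>\<^bsup>p\<^esup>\<close>.  The orthogonality condition says that \<open>0\<close> is the best constant approximation
  of \<open>f\<close>, so \<open>I \<ge> 1\<close> and \<open>h \<le> p \<tau>\<close>.\<close>

section \<open>Real powers and lower limits\<close>

text \<open>Exponents \<open>p\<close> and \<open>p / (p - 1)\<close>, applied to \<open>b\<close>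
  and \<open>a powr (p - 1)\<close>. Used for the growth of powers, for the tangent of
  \<open>\<bar>s\<bar> powr p\<close> and, weighted, for the gradient term.\<close>

lemma Youngs_inequality_powr:
  fixes a b p :: real
  assumes "1 < p" "0 \<le> a" "0 \<le> b"
  shows "p * a powr (p - 1) * b \<le> (p - 1) * a powr p + b powr p"
proof -
  have "b * a powr (p - 1) \<le> b powr p / p + (a powr (p - 1)) powr (p / (p - 1)) / (p / (p - 1))"
    using assms by (intro Youngs_inequality) (auto simp: field_simps)
  also have "(a powr (p - 1)) powr (p / (p - 1)) = a powr p"
    using assms by (simp add: powr_powr)
  finally show ?thesis
    using assms by (simp add: field_simps)
qed

text \<open>By convexity the \<open>p\<close>-th power lies above its tangent at \<open>b\<close>;
  this is Young's inequality with \<open>a\<close> and \<open>b\<close> exchanged.\<close>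

lemma powr_diff_le:
  fixes a b p :: real
  assumes "1 < p" "0 \<le> a" "0 \<le> b"
  shows "b powr p - a powr p \<le> p * b powr (p - 1) * (b - a)"
proof -
  have "b powr (p - 1) * b = b powr p"
    using assms by (cases "b = 0") (auto simp: powr_diff)
  then have "p * b powr (p - 1) * (b - a) = p * b powr p - p * b powr (p - 1) * a"
    by (simp add: algebra_simps)
  moreover have "(p - 1) * b powr p = p * b powr p - b powr p"
    by (simp add: algebra_simps)
  ultimately show ?thesis
    using Youngs_inequality_powr[OF assms(1,3,2)] by linarith
qed

text \<open>Passes from the lower limit over real radii in \<open>boundary_measure\<close> to one
  along a sequence, where Fatou's lemma applies.\<close>

lemma Liminf_le_Liminf_filterlim:
  fixes f :: "'b \<Rightarrow> 'c :: complete_lattice"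
  assumes "filterlim g F G"
  shows "Liminf F f \<le> Liminf G (\<lambda>x. f (g x))"
proof -
  have "Liminf F f \<le> Liminf (filtermap g G) f"
    using assms unfolding Liminf_def filterlim_def le_filter_def
    by (intro SUP_subset_mono) auto
  also have "\<dots> \<le> Liminf G (\<lambda>x. f (g x))"
    by (rule Liminf_filtermap_le)
  finally show ?thesis .
qed

section \<open>Neighbourhoods and Borel sets in metric measure spaces\<close>

lemma mdist_self [simp]: "x \<in> mspace X \<Longrightarrow> mdist X x x = 0"
  by simp

lemma openin_mtopology_of:
  "openin (mtopology_of X) U \<longleftrightarrow> U \<subseteq> mspace X \<and> (\<forall>x\<in>U. \<exists>r>0. mball_of X x r \<subseteq> U)"
  unfolding mtopology_of_def mball_of_def
  by (subst Metric_space.openin_mtopology) auto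

lemma openin_open_nbhd:
  assumes "A \<subseteq> mspace X"
  shows "openin (mtopology_of X) (open_nbhd X r A)"
proof -
  have "\<exists>s>0. mball_of X x s \<subseteq> open_nbhd X r A" if x: "x \<in> mspace X" and a: "a \<in> A" "mdist X x a < r" for x a
  proof (intro exI conjI subsetI)
    show "r - mdist X x a > 0" using a by simp
    fix y assume "y \<in> mball_of X x (r - mdist X x a)"
    then have y: "y \<in> mspace X" "mdist X x y < r - mdist X x a" by auto
    have "mdist X y a \<le> mdist X y x + mdist X x a"
      using x y a assms by (intro mdist_triangle) auto
    also have "mdist X y x = mdist X x y" by (rule mdist_commute)
    finally show "y \<in> open_nbhd X r A"
      using y a by (auto simp: open_nbhd_def intro!: bexI[of _ a])
  qed
  then show ?thesis
    unfolding openin_mtopology_of by (auto simp: open_nbhd_def)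
qed

lemma subset_open_nbhd:
  assumes "A \<subseteq> mspace X" "0 < r"
  shows "A \<subseteq> open_nbhd X r A"
proof
  fix x assume "x \<in> A"
  with assms show "x \<in> open_nbhd X r A"
    by (auto simp: open_nbhd_def intro!: bexI[of _ x])
qed

lemma compact_mm_space_space:
  assumes "compact_mm_space (X, \<upsilon>)"
  shows "space \<upsilon> = mspace X"
proof -
  have "sets \<upsilon> = sets (borel_sigma (mtopology_of X))"
    using assms by (simp add: compact_mm_space_def)
  then have "space \<upsilon> = space (borel_sigma (mtopology_of X))"
    by (rule sets_eq_imp_space_eq)
  moreover have "{U. openin (mtopology_of X) U} \<subseteq> Pow (mspace X)"
    using openin_subset[of "mtopology_of X"] by auto
  ultimately show ?thesis by (simp add: borel_sigma_def space_measure_of)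
qed

lemma compact_mm_space_openin:
  assumes "compact_mm_space (X, \<upsilon>)" "openin (mtopology_of X) U"
  shows "U \<in> sets \<upsilon>"
proof -
  have "{U. openin (mtopology_of X) U} \<subseteq> Pow (topspace (mtopology_of X))"
    using openin_subset by blast
  then have "U \<in> sets (borel_sigma (mtopology_of X))"
    using assms(2) unfolding borel_sigma_def by (auto intro: sigma_sets.Basic)
  then show ?thesis using assms(1) by (simp add: compact_mm_space_def)
qed

lemma compact_mm_space_continuous_measurable:
  assumes "compact_mm_space (X, \<upsilon>)" "continuous_map (mtopology_of X) euclideanreal f"
  shows "f \<in> borel_measurable \<upsilon>"
proof (rule borel_measurableI)
  fix S :: "real set" assume "open S"
  then have "openin (mtopology_of X) {x \<in> topspace (mtopology_of X). f x \<in> S}"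
    using assms(2) by (auto simp: continuous_map_def)
  then have "openin (mtopology_of X) (f -` S \<inter> space \<upsilon>)"
    using compact_mm_space_space[OF assms(1)] by (simp add: vimage_def Int_def conj_commute)
  then show "f -` S \<inter> space \<upsilon> \<in> sets \<upsilon>"
    by (rule compact_mm_space_openin[OF assms(1)])
qed

section \<open>Supremum envelopes over balls\<close>

definition sup_env :: "'a metric \<Rightarrow> real \<Rightarrow> ('a \<Rightarrow> real) \<Rightarrow> 'a \<Rightarrow> real" where
  "sup_env X r w x = (SUP y\<in>mball_of X x r. w y)"

text \<open>Strictness matters twice: a supremum exceeds \<open>t\<close> exactly when some value
  does, attained or not, and the open ball agrees with the strict inequality in
  \<open>open_nbhd\<close>. The bound \<open>C\<close> makes the real \<open>SUP\<close>
  meaningful.\<close>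

lemma less_sup_env_iff:
  assumes "x \<in> mspace X" "0 < r" "\<And>y. y \<in> mspace X \<Longrightarrow> w y \<le> C"
  shows "t < sup_env X r w x \<longleftrightarrow> x \<in> open_nbhd X r {y \<in> mspace X. t < w y}"
proof -
  have "mball_of X x r \<noteq> {}" using assms(1,2) by (auto simp: set_eq_iff intro!: exI[of _ x])
  moreover have "bdd_above (w ` mball_of X x r)"
    using assms(3) by (intro bdd_aboveI[of _ C]) auto
  ultimately show ?thesis
    unfolding sup_env_def using assms(1) by (subst less_cSUP_iff) (auto simp: open_nbhd_def)
qed

lemma sup_env_ge:
  assumes "x \<in> mspace X" "0 < r" "\<And>y. y \<in> mspace X \<Longrightarrow> w y \<le> C"
  shows "w x \<le> sup_env X r w x"
  unfolding sup_env_def using assms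
  by (intro cSUP_upper bdd_aboveI[of _ C]) auto

lemma sup_env_le:
  assumes "x \<in> mspace X" "0 < r" "\<And>y. y \<in> mball_of X x r \<Longrightarrow> w y \<le> B"
  shows "sup_env X r w x \<le> B"
  unfolding sup_env_def using assms
  by (intro cSUP_least) (auto simp: set_eq_iff intro!: exI[of _ x])

text \<open>Superlevel sets of the envelope are neighbourhoods, hence open: the envelope is lower
  semicontinuous.\<close>

lemma sup_env_measurable:
  assumes "compact_mm_space (X, \<upsilon>)" "0 < r" "\<And>y. y \<in> mspace X \<Longrightarrow> w y \<le> C"
  shows "sup_env X r w \<in> borel_measurable \<upsilon>"
proof (rule borel_measurableI_greater)
  fix t
  have "{x \<in> space \<upsilon>. t < sup_env X r w x} = open_nbhd X r {y \<in> mspace X. t < w y}"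
    using less_sup_env_iff[where w=w and C=C and X=X and r=r] assms
    by (auto simp: compact_mm_space_space[OF assms(1)] open_nbhd_def)
  moreover have "open_nbhd X r {y \<in> mspace X. t < w y} \<in> sets \<upsilon>"
    by (intro compact_mm_space_openin[OF assms(1)] openin_open_nbhd) auto
  ultimately show "{x \<in> space \<upsilon>. t < sup_env X r w x} \<in> sets \<upsilon>" by simp
qed

section \<open>The coarea inequality\<close>

text \<open>The product form also covers null sets, which the infimum in
  \<open>cheeger_const\<close> leaves out, and it can be integrated over levels.\<close>

lemma cheeger_const_mult_le:
  assumes "A \<in> sets \<upsilon>" "emeasure \<upsilon> A \<le> 1 / 2"
  shows "cheeger_const (X, \<upsilon>) * emeasure \<upsilon> A \<le> boundary_measure (X, \<upsilon>) A"
proof (cases "emeasure \<upsilon> A = 0")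
  case False
  have fin: "emeasure \<upsilon> A < \<top>"
    using assms(2) by (rule le_less_trans) (simp add: ennreal_divide_eq_top_iff flip: less_top)
  have "cheeger_const (X, \<upsilon>) \<le> boundary_measure (X, \<upsilon>) A / emeasure \<upsilon> A"
    unfolding cheeger_const_def using assms False by (auto intro!: INF_lower simp: zero_less_iff_neq_zero)
  then have "cheeger_const (X, \<upsilon>) * emeasure \<upsilon> A \<le> boundary_measure (X, \<upsilon>) A / emeasure \<upsilon> A * emeasure \<upsilon> A"
    by (rule mult_right_mono) simp
  also have "\<dots> = boundary_measure (X, \<upsilon>) A"
    using False fin by (simp add: ennreal_divide_times ennreal_mult_divide_eq less_top)
  finally show ?thesis .
qed simp

text \<open>Both integrals are areas, computed by integrating over levels \<open>t\<close>: the area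
  under \<open>w\<close> on the left, the area between \<open>w\<close> and its envelope on the
  right.\<close>

lemma cheeger_const_nn_integral_le:
  assumes mm: "compact_mm_space (X, \<upsilon>)"
    and w: "continuous_map (mtopology_of X) euclideanreal w"
    and nonneg: "\<And>x. x \<in> mspace X \<Longrightarrow> 0 \<le> w x"
    and bdd: "\<And>x. x \<in> mspace X \<Longrightarrow> w x \<le> C"
    and half: "emeasure \<upsilon> {x \<in> mspace X. 0 < w x} \<le> 1 / 2"
    and r: "\<And>n. 0 < r n" "r \<longlonglongrightarrow> 0"
  shows "cheeger_const (X, \<upsilon>) * (\<integral>\<^sup>+x. ennreal (w x) \<partial>\<upsilon>)
         \<le> liminf (\<lambda>n. \<integral>\<^sup>+x. ennreal ((sup_env X (r n) w x - w x) / r n) \<partial>\<upsilon>)"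
proof -
  interpret prob_space \<upsilon> using mm by (simp add: compact_mm_space_def)
  interpret P: pair_sigma_finite \<upsilon> lborel ..
  have sp: "space \<upsilon> = mspace X" by (rule compact_mm_space_space[OF mm])
  have [measurable]: "w \<in> borel_measurable \<upsilon>"
    by (rule compact_mm_space_continuous_measurable[OF mm w])
  define W where "W n = sup_env X (r n) w" for n
  have [measurable]: "W n \<in> borel_measurable \<upsilon>" for n
    unfolding W_def by (rule sup_env_measurable[OF mm r(1) bdd])
  define A where "A t = {x \<in> mspace X. t < w x}" for t
  have A[measurable]: "A t \<in> sets \<upsilon>" for t
    unfolding A_def sp[symmetric] by measurable
  define D where "D n t = emeasure \<upsilon> (open_nbhd X (r n) (A t)) - emeasure \<upsilon> (A t)" for n t
  \<comment> \<open>As an integral over a section of a set in the product space, the increment is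
    measurable in \<open>t\<close> and open to Tonelli's theorem.\<close>
  have D_eq: "D n t = (\<integral>\<^sup>+x. indicator {(x, t). w x \<le> t \<and> t < W n x} (x, t) \<partial>\<upsilon>)" for n t
  proof -
    have N: "open_nbhd X (r n) (A t) \<in> sets \<upsilon>"
      by (intro compact_mm_space_openin[OF mm] openin_open_nbhd) (auto simp: A_def)
    have sub: "A t \<subseteq> open_nbhd X (r n) (A t)"
      by (intro subset_open_nbhd r) (auto simp: A_def)
    have "D n t = emeasure \<upsilon> (open_nbhd X (r n) (A t) - A t)"
      unfolding D_def by (rule emeasure_Diff[symmetric]) (use N sub in auto)
    also have "\<dots> = (\<integral>\<^sup>+x. indicator (open_nbhd X (r n) (A t) - A t) x \<partial>\<upsilon>)"
      using N by simp
    also have "\<dots> = (\<integral>\<^sup>+x. indicator {(x, t). w x \<le> t \<and> t < W n x} (x, t) \<partial>\<upsilon>)"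
      unfolding W_def A_def
      using less_sup_env_iff[where w=w and X=X, OF _ r(1) bdd]
      by (intro nn_integral_cong) (auto simp: sp indicator_def)
    finally show ?thesis .
  qed
  have M: "(\<lambda>p. indicator {(x, t). w x \<le> t \<and> t < W n x} p :: ennreal) \<in> borel_measurable (\<upsilon> \<Otimes>\<^sub>M lborel)" for n
    unfolding split_beta' by measurable
  have [measurable]: "D n \<in> borel_measurable lborel" for n
    unfolding D_eq[abs_def] using M[of n] by measurable
  have int_D: "(\<integral>\<^sup>+t. D n t \<partial>lborel) = (\<integral>\<^sup>+x. ennreal (W n x - w x) \<partial>\<upsilon>)" for n
  proof -
    have "(\<integral>\<^sup>+t. D n t \<partial>lborel) = (\<integral>\<^sup>+x. (\<integral>\<^sup>+t. indicator {(x, t). w x \<le> t \<and> t < W n x} (x, t) \<partial>lborel) \<partial>\<upsilon>)"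
      unfolding D_eq by (rule P.Fubini[OF M])
    also have "\<dots> = (\<integral>\<^sup>+x. ennreal (W n x - w x) \<partial>\<upsilon>)"
    proof (intro nn_integral_cong)
      fix x assume "x \<in> space \<upsilon>"
      have "(\<integral>\<^sup>+t. indicator {(x, t). w x \<le> t \<and> t < W n x} (x, t) \<partial>lborel)
          = (\<integral>\<^sup>+t. indicator {w x..<W n x} t \<partial>lborel)"
        by (intro nn_integral_cong) (auto simp: indicator_def)
      also have "\<dots> = emeasure lborel {w x..<W n x}" by simp
      also have "\<dots> = ennreal (W n x - w x)"
        using sup_env_ge[of x X "r n" w C] \<open>x \<in> space \<upsilon>\<close> bdd r(1) by (simp add: sp W_def)
      finally show "(\<integral>\<^sup>+t. indicator {(x, t). w x \<le> t \<and> t < W n x} (x, t) \<partial>lborel) = ennreal (W n x - w x)" .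
    qed
    finally show ?thesis .
  qed
  have M0: "(\<lambda>p. indicator {(x, t). 0 \<le> t \<and> t < w x} p :: ennreal) \<in> borel_measurable (\<upsilon> \<Otimes>\<^sub>M lborel)"
    unfolding split_beta' by measurable
  \<comment> \<open>For \<open>t < 0\<close> the set \<open>A t\<close> is the whole space, too
    large for the Cheeger constant; the condition \<open>0 \<le> t\<close> makes \<open>F\<close>
    vanish there.\<close>
  define F where "F t = (\<integral>\<^sup>+x. indicator {(x, t). 0 \<le> t \<and> t < w x} (x, t) \<partial>\<upsilon>)" for t
  have [measurable]: "F \<in> borel_measurable lborel"
    unfolding F_def[abs_def] using M0 by measurable
  have int_w: "(\<integral>\<^sup>+x. ennreal (w x) \<partial>\<upsilon>) = (\<integral>\<^sup>+t. F t \<partial>lborel)"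
  proof -
    have "(\<integral>\<^sup>+t. F t \<partial>lborel) = (\<integral>\<^sup>+x. (\<integral>\<^sup>+t. indicator {(x, t). 0 \<le> t \<and> t < w x} (x, t) \<partial>lborel) \<partial>\<upsilon>)"
      unfolding F_def by (rule P.Fubini[OF M0])
    also have "\<dots> = (\<integral>\<^sup>+x. ennreal (w x) \<partial>\<upsilon>)"
    proof (intro nn_integral_cong)
      fix x assume "x \<in> space \<upsilon>"
      have "(\<integral>\<^sup>+t. indicator {(x, t). 0 \<le> t \<and> t < w x} (x, t) \<partial>lborel)
          = (\<integral>\<^sup>+t. indicator {0..<w x} t \<partial>lborel)"
        by (intro nn_integral_cong) (auto simp: indicator_def)
      also have "\<dots> = emeasure lborel {0..<w x}" by simp
      also have "\<dots> = ennreal (w x)"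
        using nonneg \<open>x \<in> space \<upsilon>\<close> by (simp add: sp)
      finally show "(\<integral>\<^sup>+t. indicator {(x, t). 0 \<le> t \<and> t < w x} (x, t) \<partial>lborel) = ennreal (w x)" .
    qed
    finally show ?thesis by simp
  qed
  have at_right: "filterlim r (at_right 0) sequentially"
    unfolding filterlim_at using r by (auto simp: less_imp_neq[THEN not_sym])
  have le: "cheeger_const (X, \<upsilon>) * F t \<le> liminf (\<lambda>n. D n t / ennreal (r n))" for t
  proof (cases "0 \<le> t")
    case True
    have "F t = (\<integral>\<^sup>+x. indicator (A t) x \<partial>\<upsilon>)"
      unfolding F_def A_def using True by (intro nn_integral_cong) (auto simp: sp indicator_def)
    then have "F t = emeasure \<upsilon> (A t)" by simp
    moreover have "emeasure \<upsilon> (A t) \<le> 1 / 2"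
    proof -
      have "emeasure \<upsilon> (A t) \<le> emeasure \<upsilon> (A 0)"
        using True by (intro emeasure_mono A) (auto simp: A_def)
      with half show ?thesis by (simp add: A_def)
    qed
    ultimately have "cheeger_const (X, \<upsilon>) * F t \<le> boundary_measure (X, \<upsilon>) (A t)"
      using cheeger_const_mult_le[OF A] by simp
    also have "\<dots> \<le> liminf (\<lambda>n. D n t / ennreal (r n))"
      unfolding boundary_measure_def D_def prod.case
      by (rule Liminf_le_Liminf_filterlim[OF at_right])
    finally show ?thesis .
  next
    case False
    then have "F t = 0" by (simp add: F_def)
    then show ?thesis by simp
  qed
  have "cheeger_const (X, \<upsilon>) * (\<integral>\<^sup>+x. ennreal (w x) \<partial>\<upsilon>) = (\<integral>\<^sup>+t. cheeger_const (X, \<upsilon>) * F t \<partial>lborel)"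
    unfolding int_w by (rule nn_integral_cmult[symmetric]) simp
  also have "\<dots> \<le> (\<integral>\<^sup>+t. liminf (\<lambda>n. D n t / ennreal (r n)) \<partial>lborel)"
    by (rule nn_integral_mono) (rule le)
  also have "\<dots> \<le> liminf (\<lambda>n. \<integral>\<^sup>+t. D n t / ennreal (r n) \<partial>lborel)"
    by (intro nn_integral_liminf) measurable
  also have "(\<lambda>n. \<integral>\<^sup>+t. D n t / ennreal (r n) \<partial>lborel) = (\<lambda>n. \<integral>\<^sup>+x. ennreal ((W n x - w x) / r n) \<partial>\<upsilon>)"
  proof
    fix n
    have "(\<integral>\<^sup>+t. D n t / ennreal (r n) \<partial>lborel) = (\<integral>\<^sup>+x. ennreal (W n x - w x) \<partial>\<upsilon>) / ennreal (r n)"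
      by (simp add: nn_integral_divide int_D)
    also have "\<dots> = (\<integral>\<^sup>+x. ennreal (W n x - w x) / ennreal (r n) \<partial>\<upsilon>)"
      by (simp add: nn_integral_divide)
    also have "\<dots> = (\<integral>\<^sup>+x. ennreal ((W n x - w x) / r n) \<partial>\<upsilon>)"
    proof (intro nn_integral_cong)
      fix x assume "x \<in> space \<upsilon>"
      then have "w x \<le> W n x"
        using sup_env_ge[of x X "r n" w C] bdd r(1) by (simp add: sp W_def)
      then show "ennreal (W n x - w x) / ennreal (r n) = ennreal ((W n x - w x) / r n)"
        using r(1) by (intro divide_ennreal) auto
    qed
    finally show "(\<integral>\<^sup>+t. D n t / ennreal (r n) \<partial>lborel) = (\<integral>\<^sup>+x. ennreal ((W n x - w x) / r n) \<partial>\<upsilon>)" .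
  qed
  finally show ?thesis unfolding W_def .
qed

section \<open>The pointwise Lipschitz constant\<close>

text \<open>The supremum of the difference quotients over a punctured ball is monotone in the radius
  and bounded, so the \<open>Lim\<close> in \<open>Lip\<close> is a true limit. At isolated points
  the zero function serves as \<open>S\<close>, which spares later proofs the case
  distinction.\<close>

lemma Lip_slope_bound:
  assumes L: "\<And>y z. y \<in> mspace X \<Longrightarrow> z \<in> mspace X \<Longrightarrow> \<bar>f y - f z\<bar> \<le> L * mdist X y z"
    and x: "x \<in> mspace X"
  obtains S where "(S \<longlongrightarrow> Lip X f x) (at_right 0)"
    and "eventually (\<lambda>r. 0 \<le> S r \<and> (\<forall>y\<in>mball_of X x r. \<bar>f y - f x\<bar> \<le> S r * r)) (at_right 0)"
proof (cases "openin (mtopology_of X) {x}")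
  case True
  then obtain e where e: "0 < e" "mball_of X x e \<subseteq> {x}"
    by (auto simp: openin_mtopology_of)
  have "eventually (\<lambda>r. r < e) (at_right 0)"
    using e(1) by (auto simp: eventually_at_right_field)
  then have "eventually (\<lambda>r. 0 \<le> (0::real) \<and> (\<forall>y\<in>mball_of X x r. \<bar>f y - f x\<bar> \<le> 0 * r)) (at_right 0)"
  proof eventually_elim
    case (elim r)
    then have "mball_of X x r \<subseteq> mball_of X x e" by auto
    with e(2) show ?case by auto
  qed
  moreover have "((\<lambda>r. 0) \<longlongrightarrow> Lip X f x) (at_right 0)"
    using True by (simp add: Lip_def)
  ultimately show thesis using that by blast
next
  case False
  define q where "q y = \<bar>f x - f y\<bar> / mdist X x y" for y
  define S where "S r = (SUP y\<in>mball_of X x r - {x}. q y)" for r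
  have ne: "mball_of X x r - {x} \<noteq> {}" if "0 < r" for r
    using False x that by (auto simp: openin_mtopology_of)
  have q_le: "q y \<le> L" if "y \<in> mball_of X x r - {x}" for y r
    using that L[of x y] by (auto simp: q_def divide_le_eq less_le)
  then have bdd: "bdd_above (q ` (mball_of X x r - {x}))" for r
    by (intro bdd_aboveI2[where M = L])
  have q_nonneg: "0 \<le> q y" for y by (simp add: q_def)
  have S_nonneg: "0 \<le> S r" if "0 < r" for r
  proof -
    obtain y where "y \<in> mball_of X x r - {x}" using ne[OF \<open>0 < r\<close>] by blast
    then have "q y \<le> S r" unfolding S_def by (intro cSUP_upper bdd)
    with q_nonneg[of y] show ?thesis by simp
  qed
  have S_mono: "S r \<le> S s" if "0 < r" "r \<le> s" for r s
    unfolding S_def using that by (intro cSUP_subset_mono ne bdd) auto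
  \<comment> \<open>By monotonicity, the infimum over positive radii is the right limit at
    0.\<close>
  define l where "l = (INF r\<in>{0<..}. S r)"
  have l_le: "l \<le> S r" if "0 < r" for r
    unfolding l_def using that S_nonneg by (intro cINF_lower bdd_belowI[of _ 0]) auto
  have lim: "(S \<longlongrightarrow> l) (at_right 0)"
  proof (rule order_tendstoI)
    fix a assume "a < l"
    have "eventually (\<lambda>r::real. 0 < r) (at_right 0)" by (simp add: eventually_at_right_less)
    then show "eventually (\<lambda>r. a < S r) (at_right 0)"
      by eventually_elim (use l_le \<open>a < l\<close> in \<open>force intro: less_le_trans\<close>)
  next
    fix a assume "l < a"
    then obtain s where s: "0 < s" "S s < a"
      unfolding l_def using S_nonneg by (subst (asm) cINF_less_iff) (auto intro: bdd_belowI[of _ 0])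
    show "eventually (\<lambda>r. S r < a) (at_right 0)"
      unfolding eventually_at_right_field
      using s S_mono by (intro exI[of _ s]) (auto intro: le_less_trans less_imp_le)
  qed
  have "Lim (at_right 0) S = l"
    by (rule tendsto_Lim[OF _ lim]) simp
  then have "Lip X f x = l"
    using False by (simp add: Lip_def S_def[abs_def] q_def)
  with lim have "(S \<longlongrightarrow> Lip X f x) (at_right 0)" by simp
  moreover have "eventually (\<lambda>r. 0 \<le> S r \<and> (\<forall>y\<in>mball_of X x r. \<bar>f y - f x\<bar> \<le> S r * r)) (at_right 0)"
    using eventually_at_right_less[of "0::real"]
  proof eventually_elim
    case (elim r)
    have "\<bar>f y - f x\<bar> \<le> S r * r" if y: "y \<in> mball_of X x r" for y
    proof (cases "y = x")
      case False
      have "q y \<le> S r" unfolding S_def using y False by (intro cSUP_upper bdd) auto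
      moreover have "0 < mdist X x y" using y False by (simp add: less_le)
      ultimately have "\<bar>f y - f x\<bar> \<le> S r * mdist X x y"
        by (simp add: q_def divide_le_eq abs_minus_commute)
      also have "\<dots> \<le> S r * r"
        using y S_nonneg[OF elim] by (intro mult_left_mono) auto
      finally show ?thesis .
    qed (use elim S_nonneg in auto)
    with S_nonneg[OF elim] show ?case by auto
  qed
  ultimately show thesis using that by blast
qed

lemma Lip_nonneg:
  assumes L: "\<And>y z. y \<in> mspace X \<Longrightarrow> z \<in> mspace X \<Longrightarrow> \<bar>f y - f z\<bar> \<le> L * mdist X y z"
    and x: "x \<in> mspace X"
  shows "0 \<le> Lip X f x"
proof -
  obtain S where S: "(S \<longlongrightarrow> Lip X f x) (at_right 0)"
    "eventually (\<lambda>r. 0 \<le> S r \<and> (\<forall>y\<in>mball_of X x r. \<bar>f y - f x\<bar> \<le> S r * r)) (at_right 0)"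
    using Lip_slope_bound[OF L x] by blast
  from S(2) have "eventually (\<lambda>r. 0 \<le> S r) (at_right 0)" by eventually_elim simp
  with S(1) show ?thesis by (intro tendsto_lowerbound) auto
qed

lemma Lip_uminus: "Lip X (\<lambda>x. - f x) x = Lip X f x"
proof -
  have "\<bar>- f x - - f y\<bar> = \<bar>f x - f y\<bar>" for y by simp
  then show ?thesis by (simp only: Lip_def)
qed

section \<open>Slopes of powers of the positive part of \<open>f - m\<close>\<close>

text \<open>\<open>B\<close> and \<open>D\<close> are kept apart for two uses: a global bound with
  \<open>L * r n\<close> yields an integrable majorant, and \<open>u + L * r n\<close> with the
  local slope yields the sharp limit.\<close>

lemma pos_part_powr_diff_le:
  fixes a b m p B D :: real
  assumes "1 < p" "max 0 (b - m) \<le> B" "\<bar>b - a\<bar> \<le> D"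
  shows "max 0 (b - m) powr p - max 0 (a - m) powr p \<le> p * B powr (p - 1) * D"
proof -
  have "max 0 (b - m) powr p - max 0 (a - m) powr p
      \<le> p * max 0 (b - m) powr (p - 1) * (max 0 (b - m) - max 0 (a - m))"
    using assms by (intro powr_diff_le) auto
  also have "\<dots> \<le> p * max 0 (b - m) powr (p - 1) * D"
    using assms by (intro mult_left_mono) auto
  also have "\<dots> \<le> p * B powr (p - 1) * D"
    using assms by (intro mult_right_mono mult_left_mono powr_mono2) auto
  finally show ?thesis .
qed

text \<open>The global Lipschitz constant only controls the base of the power, which tends to
  \<open>u\<close>; the sharp factor comes from the local slope \<open>S (r n)\<close>.\<close>

lemma limsup_sup_env_slope_le:
  fixes f :: "'a \<Rightarrow> real"
  defines "w \<equiv> \<lambda>m p y. max 0 (f y - m) powr p"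
  assumes L: "0 < L" "\<And>y z. y \<in> mspace X \<Longrightarrow> z \<in> mspace X \<Longrightarrow> \<bar>f y - f z\<bar> \<le> L * mdist X y z"
    and x: "x \<in> mspace X" and p: "1 < p" and r: "\<And>n. 0 < r n" "r \<longlonglongrightarrow> 0"
  shows "limsup (\<lambda>n. ennreal ((sup_env X (r n) (w m p) x - w m p x) / r n))
    \<le> ennreal (p * w m (p - 1) x * Lip X f x)"
proof -
  obtain S where S: "(S \<longlongrightarrow> Lip X f x) (at_right 0)"
    "eventually (\<lambda>r. 0 \<le> S r \<and> (\<forall>y\<in>mball_of X x r. \<bar>f y - f x\<bar> \<le> S r * r)) (at_right 0)"
    using Lip_slope_bound[OF L(2) x] by blast
  have at_right: "filterlim r (at_right 0) sequentially"
    unfolding filterlim_at using r by (auto simp: less_imp_neq[THEN not_sym])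
  define u where "u = max 0 (f x - m)"
  define R where "R n = p * (u + L * r n) powr (p - 1) * S (r n)" for n
  have "eventually (\<lambda>n. 0 \<le> S (r n) \<and> (\<forall>y\<in>mball_of X x (r n). \<bar>f y - f x\<bar> \<le> S (r n) * r n)) sequentially"
    using S(2) at_right unfolding filterlim_iff by auto
  then have "eventually (\<lambda>n. ennreal ((sup_env X (r n) (w m p) x - w m p x) / r n) \<le> ennreal (R n)) sequentially"
  proof eventually_elim
    case (elim n)
    have "sup_env X (r n) (w m p) x \<le> w m p x + R n * r n"
    proof (rule sup_env_le[OF x r(1)])
      fix y assume y: "y \<in> mball_of X x (r n)"
      have "\<bar>f y - f x\<bar> \<le> L * mdist X y x" using y by (intro L(2)) auto
      also have "\<dots> \<le> L * r n" using y L(1) by (intro mult_left_mono) (auto simp: mdist_commute)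
      finally have "max 0 (f y - m) \<le> u + L * r n"
        using L(1) r(1)[of n] by (auto simp: u_def max_def intro: order_trans)
      from pos_part_powr_diff_le[OF p this, of "f x" "S (r n) * r n"]
      show "w m p y \<le> w m p x + R n * r n"
        using elim y by (simp add: w_def R_def mult.assoc)
    qed
    then show ?case using r(1)[of n] by (intro ennreal_leI) (simp add: divide_le_eq)
  qed
  then have "limsup (\<lambda>n. ennreal ((sup_env X (r n) (w m p) x - w m p x) / r n)) \<le> limsup (\<lambda>n. ennreal (R n))"
    by (rule Limsup_mono)
  \<comment> \<open>The limit \<open>u\<close> of the base may be 0; convergence then rests on
    \<open>p - 1 > 0\<close> and nonnegative bases.\<close>
  also have "R \<longlonglongrightarrow> p * (u + L * 0) powr (p - 1) * Lip X f x"
    unfolding R_def using p L(1) r less_imp_le[OF r(1)]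
    by (intro tendsto_mult tendsto_const tendsto_powr' tendsto_add filterlim_compose[OF S(1) at_right])
       (auto simp: u_def intro!: always_eventually)
  then have "(\<lambda>n. ennreal (R n)) \<longlonglongrightarrow> ennreal (p * w m (p - 1) x * Lip X f x)"
    by (intro tendsto_ennrealI) (simp add: w_def u_def)
  then have "limsup (\<lambda>n. ennreal (R n)) = ennreal (p * w m (p - 1) x * Lip X f x)"
    by (intro lim_imp_Limsup) auto
  finally show ?thesis .
qed

lemma Lipschitz_real_imp_continuous_map:
  assumes L: "0 < L" "\<And>y z. y \<in> mspace X \<Longrightarrow> z \<in> mspace X \<Longrightarrow> \<bar>f y - f z\<bar> \<le> L * mdist X y z"
  shows "continuous_map (mtopology_of X) euclideanreal f"
proof -
  have "Lipschitz_continuous_map X euclidean_metric f"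
    unfolding Lipschitz_continuous_map_def using L by (auto simp: dist_real_def)
  from Lipschitz_continuous_imp_continuous_map[OF this] show ?thesis by simp
qed

lemma compact_continuous_map_bounded:
  assumes "compact_space T" "continuous_map T euclideanreal f"
  obtains C where "\<And>x. x \<in> topspace T \<Longrightarrow> \<bar>f x\<bar> \<le> C"
proof -
  have "compactin euclideanreal (f ` topspace T)"
    using assms image_compactin unfolding compact_space_def by blast
  then have "bounded (f ` topspace T)"
    by (simp add: compact_imp_bounded)
  then show thesis using that unfolding bounded_iff by auto
qed

text \<open>\<open>G\<close> is the upper limit of the difference quotients along shrinking radii.
  It is measurable by construction and stands in for its pointwise bound, which contains
  \<open>Lip X f\<close>.\<close>

lemma cheeger_const_pos_part_le:
  fixes f :: "'a \<Rightarrow> real"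
  assumes mm: "compact_mm_space (X, \<upsilon>)"
    and L: "0 < L" "\<And>y z. y \<in> mspace X \<Longrightarrow> z \<in> mspace X \<Longrightarrow> \<bar>f y - f z\<bar> \<le> L * mdist X y z"
    and p: "1 < p" and half: "emeasure \<upsilon> {x \<in> mspace X. m < f x} \<le> 1 / 2"
  obtains G where "G \<in> borel_measurable \<upsilon>"
    and "cheeger_const (X, \<upsilon>) * (\<integral>\<^sup>+x. ennreal (max 0 (f x - m) powr p) \<partial>\<upsilon>) \<le> (\<integral>\<^sup>+x. G x \<partial>\<upsilon>)"
    and "\<And>x. x \<in> mspace X \<Longrightarrow> G x \<le> ennreal (p * max 0 (f x - m) powr (p - 1) * Lip X f x)"
proof -
  interpret prob_space \<upsilon> using mm by (simp add: compact_mm_space_def)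
  have sp: "space \<upsilon> = mspace X" by (rule compact_mm_space_space[OF mm])
  have cf: "continuous_map (mtopology_of X) euclideanreal f"
    using Lipschitz_real_imp_continuous_map[OF L] .
  have "compact_space (mtopology_of X)" using mm by (simp add: compact_mm_space_def)
  then obtain C where C: "\<And>x. x \<in> mspace X \<Longrightarrow> \<bar>f x\<bar> \<le> C"
    using compact_continuous_map_bounded[OF _ cf] by auto
  define B where "B = C + \<bar>m\<bar>"
  have B: "max 0 (f x - m) \<le> B" if "x \<in> mspace X" for x
    using C[OF that] by (auto simp: B_def)
  define w where "w y = max 0 (f y - m) powr p" for y
  have w_le: "w x \<le> B powr p" if "x \<in> mspace X" for x
    unfolding w_def using B[OF that] p by (intro powr_mono2) auto
  have cw: "continuous_map (mtopology_of X) euclideanreal w"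
  proof -
    have "continuous_on UNIV (\<lambda>s::real. max 0 (s - m) powr p)"
      using p by (intro continuous_on_powr' continuous_intros) auto
    then have "continuous_map euclideanreal euclideanreal (\<lambda>s::real. max 0 (s - m) powr p)"
      by simp
    from continuous_map_compose[OF cf this] show ?thesis
      by (simp add: w_def[abs_def] comp_def)
  qed
  define r where "r n = inverse (real (Suc n))" for n
  have r: "0 < r n" "r \<longlonglongrightarrow> 0" for n
    unfolding r_def using LIMSEQ_inverse_real_of_nat by auto
  define g where "g n x = ennreal ((sup_env X (r n) w x - w x) / r n)" for n x
  have [measurable]: "w \<in> borel_measurable \<upsilon>"
    by (rule compact_mm_space_continuous_measurable[OF mm cw])
  have [measurable]: "sup_env X (r n) w \<in> borel_measurable \<upsilon>" for n
    by (rule sup_env_measurable[OF mm r(1) w_le])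
  have g[measurable]: "g n \<in> borel_measurable \<upsilon>" for n
    unfolding g_def[abs_def] by measurable
  \<comment> \<open>A bound uniform in \<open>n\<close> and \<open>x\<close>: the majorant for the
    reverse Fatou lemma on a probability space.\<close>
  have g_le: "g n x \<le> ennreal (p * B powr (p - 1) * L)" if x: "x \<in> mspace X" for n x
  proof -
    have "sup_env X (r n) w x \<le> w x + p * B powr (p - 1) * (L * r n)"
    proof (rule sup_env_le[OF x r(1)])
      fix y assume y: "y \<in> mball_of X x (r n)"
      have "\<bar>f y - f x\<bar> \<le> L * mdist X y x" using y by (intro L(2)) auto
      also have "\<dots> \<le> L * r n" using y L(1) by (intro mult_left_mono) (auto simp: mdist_commute)
      finally show "w y \<le> w x + p * B powr (p - 1) * (L * r n)"
        using pos_part_powr_diff_le[OF p B, of y "f x" "L * r n"] y by (simp add: w_def)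
    qed
    then show ?thesis
      unfolding g_def using r(1)[of n] by (intro ennreal_leI) (simp add: divide_le_eq mult.assoc)
  qed
  show thesis
  proof (rule that)
    show "(\<lambda>x. limsup (\<lambda>n. g n x)) \<in> borel_measurable \<upsilon>" by measurable
    show "limsup (\<lambda>n. g n x) \<le> ennreal (p * max 0 (f x - m) powr (p - 1) * Lip X f x)"
      if "x \<in> mspace X" for x
      using limsup_sup_env_slope_le[OF L that p r, of m] unfolding g_def w_def by simp
    have "emeasure \<upsilon> {x \<in> mspace X. 0 < w x} \<le> 1 / 2"
    proof -
      have "{x \<in> mspace X. 0 < w x} = {x \<in> mspace X. m < f x}" by (auto simp: w_def)
      with half show ?thesis by simp
    qed
    then have "cheeger_const (X, \<upsilon>) * (\<integral>\<^sup>+x. ennreal (w x) \<partial>\<upsilon>) \<le> liminf (\<lambda>n. \<integral>\<^sup>+x. g n x \<partial>\<upsilon>)"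
      unfolding g_def using w_le
      by (intro cheeger_const_nn_integral_le[OF mm cw _ _ _ r]) (auto simp: w_def)
    \<comment> \<open>The reverse Fatou lemma bounds upper limits of integrals, so the lower limit
      from the coarea inequality is first enlarged.\<close>
    also have "\<dots> \<le> limsup (\<lambda>n. \<integral>\<^sup>+x. g n x \<partial>\<upsilon>)"
      by (intro Liminf_le_Limsup) simp
    also have "\<dots> \<le> (\<integral>\<^sup>+x. limsup (\<lambda>n. g n x) \<partial>\<upsilon>)"
      using g_le by (intro nn_integral_limsup[where w = "\<lambda>_. ennreal (p * B powr (p - 1) * L)"])
        (auto simp: sp emeasure_space_1[unfolded sp])
    finally show "cheeger_const (X, \<upsilon>) * (\<integral>\<^sup>+x. ennreal (max 0 (f x - m) powr p) \<partial>\<upsilon>)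
        \<le> (\<integral>\<^sup>+x. limsup (\<lambda>n. g n x) \<partial>\<upsilon>)"
      unfolding w_def .
  qed
qed

section \<open>Medians and best constant approximation\<close>

text \<open>Take the infimum of all \<open>t\<close> where the distribution function is at least
  \<open>1 / 2\<close>: right continuity bounds the mass above it, the left limit the mass below it.
  An atom at \<open>m\<close> lies in neither set.\<close>

lemma (in prob_space) median_exists:
  assumes f[measurable]: "f \<in> borel_measurable M"
  obtains m :: real where "prob {x \<in> space M. m < f x} \<le> 1 / 2" "prob {x \<in> space M. f x < m} \<le> 1 / 2"
proof -
  define N where "N = distr M borel f"
  interpret N: real_distribution N
    unfolding N_def by (rule real_distribution_distr) simp
  define T where "T = {t. 1 / 2 \<le> cdf N t}"
  have "eventually (\<lambda>t. 1 / 2 < cdf N t) at_top"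
    using N.cdf_lim_at_top_prob by (rule order_tendstoD) simp
  then have ne: "T \<noteq> {}"
    unfolding T_def by (auto dest!: eventually_happens' [rotated] intro: less_imp_le)
  have "eventually (\<lambda>t. cdf N t < 1 / 2) at_bot"
    using N.cdf_lim_at_bot by (rule order_tendstoD) simp
  then obtain b where b: "\<And>t. t \<le> b \<Longrightarrow> cdf N t < 1 / 2"
    unfolding eventually_at_bot_linorder by auto
  have bdd: "bdd_below T"
    using b unfolding T_def by (intro bdd_belowI[of _ b]) (auto simp: not_less[symmetric] intro: less_imp_le)
  define m where "m = Inf T"
  have "1 / 2 \<le> cdf N m"
  proof (rule tendsto_lowerbound)
    show "(cdf N \<longlongrightarrow> cdf N m) (at_right m)"
      using N.cdf_is_right_cont[of m] by (simp add: continuous_within)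
    show "eventually (\<lambda>t. 1 / 2 \<le> cdf N t) (at_right m)"
      using eventually_at_right_less[of m]
    proof eventually_elim
      case (elim t)
      then obtain s where "s \<in> T" "s < t"
        unfolding m_def using ne bdd by (auto simp: cInf_less_iff)
      then show ?case
        using N.cdf_nondecreasing[of s t] by (auto simp: T_def)
    qed
  qed simp
  moreover have "measure N {..<m} \<le> 1 / 2"
  proof (rule tendsto_upperbound[OF N.cdf_at_left])
    show "eventually (\<lambda>t. cdf N t \<le> 1 / 2) (at_left m)"
      unfolding eventually_at_left_field
    proof (intro exI[of _ "m - 1"] conjI allI impI)
      fix t assume "t < m"
      then have "t \<notin> T" unfolding m_def using bdd by (meson cInf_lower not_less)
      then show "cdf N t \<le> 1 / 2" by (simp add: T_def)
    qed simp
  qed simp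
  moreover have "measure N {..<m} = prob {x \<in> space M. f x < m}"
    unfolding N_def by (subst measure_distr) (auto intro!: arg_cong[where f = prob])
  moreover have "cdf N m = 1 - prob {x \<in> space M. m < f x}"
  proof -
    have "cdf N m = prob {x \<in> space M. \<not> m < f x}"
      unfolding N_def cdf_def by (subst measure_distr) (auto intro!: arg_cong[where f = prob])
    also have "\<dots> = 1 - prob {x \<in> space M. m < f x}"
      by (rule prob_neg) measurable
    finally show ?thesis .
  qed
  ultimately show thesis using that[of m] by simp
qed

lemma compact_mm_space_integrable:
  assumes mm: "compact_mm_space (X, \<upsilon>)" and h: "h \<in> borel_measurable \<upsilon>"
    and b: "\<And>x. x \<in> mspace X \<Longrightarrow> \<bar>h x\<bar> \<le> (B::real)"
  shows "integrable \<upsilon> h"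
proof -
  interpret prob_space \<upsilon> using mm by (simp add: compact_mm_space_def)
  show ?thesis
    using h b by (intro integrable_const_bound[where B = B]) (auto simp: compact_mm_space_space[OF mm])
qed

text \<open>Up to the factor \<open>p\<close>, \<open>\<bar>s\<bar> powr (p - 2) * s\<close> is the
  derivative of \<open>\<bar>s\<bar> powr p\<close>. So \<open>zero\<close> is a first-order
  condition, and convexity turns the critical constant 0 into a minimizer.\<close>

lemma integral_abs_powr_shift_ge:
  fixes f :: "'a \<Rightarrow> real"
  assumes mm: "compact_mm_space (X, \<upsilon>)" and p: "1 < p"
    and f[measurable]: "f \<in> borel_measurable \<upsilon>" and C: "\<And>x. x \<in> mspace X \<Longrightarrow> \<bar>f x\<bar> \<le> C"
    and zero: "(\<integral>x. \<bar>f x\<bar> powr (p - 2) * f x \<partial>\<upsilon>) = 0"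
  shows "(\<integral>x. \<bar>f x\<bar> powr p \<partial>\<upsilon>) \<le> (\<integral>x. \<bar>f x - m\<bar> powr p \<partial>\<upsilon>)"
proof -
  \<comment> \<open>Since \<open>0 powr q = 0\<close>, this holds at \<open>s = 0\<close> too and
    keeps \<open>\<bar>s\<bar> powr (p - 2) * s\<close> bounded on bounded sets even for
    \<open>p < 2\<close>.\<close>
  have abs_eq: "\<bar>s\<bar> powr (p - 2) * \<bar>s\<bar> = \<bar>s\<bar> powr (p - 1)" for s :: real
    using powr_mult_base[of "\<bar>s\<bar>" "p - 2"] by (simp add: mult.commute)
  have i1: "integrable \<upsilon> (\<lambda>x. \<bar>f x\<bar> powr p)"
    using C p by (intro compact_mm_space_integrable[OF mm, where B = "C powr p"]) (auto intro!: powr_mono2)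
  have i2: "integrable \<upsilon> (\<lambda>x. \<bar>f x\<bar> powr (p - 2) * f x)"
    using C p by (intro compact_mm_space_integrable[OF mm, where B = "C powr (p - 1)"])
      (auto simp: abs_mult abs_eq intro!: powr_mono2)
  have i3: "integrable \<upsilon> (\<lambda>x. \<bar>f x - m\<bar> powr p)"
  proof (rule compact_mm_space_integrable[OF mm, where B = "(C + \<bar>m\<bar>) powr p"])
    fix x assume "x \<in> mspace X"
    then have "\<bar>f x - m\<bar> \<le> C + \<bar>m\<bar>" using C[of x] by auto
    then show "\<bar>\<bar>f x - m\<bar> powr p\<bar> \<le> (C + \<bar>m\<bar>) powr p" using p by (auto intro!: powr_mono2)
  qed measurable
  \<comment> \<open>The tangent line of the convex function \<open>\<bar>s\<bar> powr p\<close> lies below its graph.\<close>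
  have tangent: "\<bar>s\<bar> powr p - p * m * (\<bar>s\<bar> powr (p - 2) * s) \<le> \<bar>s - m\<bar> powr p" for s :: real
  proof -
    \<comment> \<open>Young's inequality for \<open>\<bar>s\<bar>\<close> and
      \<open>\<bar>s - m\<bar>\<close>; expanding \<open>s * (s - m)\<close> produces the term
      linear in \<open>m\<close>.\<close>
    have "p * (\<bar>s\<bar> powr (p - 2) * (s * (s - m))) \<le> p * (\<bar>s\<bar> powr (p - 2) * (\<bar>s\<bar> * \<bar>s - m\<bar>))"
      using p by (intro mult_left_mono) (auto simp flip: abs_mult)
    also have "\<dots> = p * \<bar>s\<bar> powr (p - 1) * \<bar>s - m\<bar>"
      by (simp add: abs_eq flip: mult.assoc)
    also have "\<dots> \<le> (p - 1) * \<bar>s\<bar> powr p + \<bar>s - m\<bar> powr p"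
      using p by (intro Youngs_inequality_powr) auto
    finally have "p * (\<bar>s\<bar> powr (p - 2) * (s * s)) - p * m * (\<bar>s\<bar> powr (p - 2) * s)
        \<le> (p - 1) * \<bar>s\<bar> powr p + \<bar>s - m\<bar> powr p"
      by (simp add: algebra_simps)
    moreover have "\<bar>s\<bar> powr (p - 2) * (s * s) = \<bar>s\<bar> powr p"
      using powr_mult_base[of "\<bar>s\<bar>" "p - 1"] abs_eq[of s]
      by (metis abs_ge_zero abs_mult_self_eq add.commute diff_add_cancel mult.assoc mult.commute)
    ultimately show ?thesis by (simp add: algebra_simps)
  qed
  have "(\<integral>x. \<bar>f x\<bar> powr p \<partial>\<upsilon>) = (\<integral>x. \<bar>f x\<bar> powr p - p * m * (\<bar>f x\<bar> powr (p - 2) * f x) \<partial>\<upsilon>)"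
    using i1 i2 zero by simp
  also have "\<dots> \<le> (\<integral>x. \<bar>f x - m\<bar> powr p \<partial>\<upsilon>)"
    using i1 i2 i3 by (intro integral_mono tangent) auto
  finally show ?thesis .
qed

section \<open>Cheeger's inequality\<close>

lemma cheeger_const_le_of_Lip_integral_less:
  fixes f :: "'a \<Rightarrow> real"
  assumes mm: "compact_mm_space (X, \<upsilon>)" and p: "1 < p" and \<tau>: "0 < \<tau>"
    and lip: "Lipschitz_continuous_map X euclidean_metric f"
    and norm: "(\<integral>x. \<bar>f x\<bar> powr p \<partial>\<upsilon>) = 1"
    and zero: "(\<integral>x. \<bar>f x\<bar> powr (p - 2) * f x \<partial>\<upsilon>) = 0"
    and less: "(\<integral>\<^sup>+x. ennreal (Lip X f x powr p) \<partial>\<upsilon>) < ennreal (\<tau> powr p)"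
  shows "cheeger_const (X, \<upsilon>) \<le> ennreal (p * \<tau>)"
proof -
  interpret prob_space \<upsilon> using mm by (simp add: compact_mm_space_def)
  have sp: "space \<upsilon> = mspace X" by (rule compact_mm_space_space[OF mm])
  obtain L where L: "0 < L" "\<And>y z. y \<in> mspace X \<Longrightarrow> z \<in> mspace X \<Longrightarrow> \<bar>f y - f z\<bar> \<le> L * mdist X y z"
    using lip unfolding Lipschitz_continuous_map_pos by (auto simp: dist_real_def)
  then have L': "\<bar>- f y - - f z\<bar> \<le> L * mdist X y z" if "y \<in> mspace X" "z \<in> mspace X" for y z
    using that by (simp add: abs_minus_commute)
  have cf: "continuous_map (mtopology_of X) euclideanreal f"
    using Lipschitz_real_imp_continuous_map[OF L] .
  have f[measurable]: "f \<in> borel_measurable \<upsilon>"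
    by (rule compact_mm_space_continuous_measurable[OF mm cf])
  have "compact_space (mtopology_of X)" using mm by (simp add: compact_mm_space_def)
  then obtain C where C: "\<And>x. x \<in> mspace X \<Longrightarrow> \<bar>f x\<bar> \<le> C"
    using compact_continuous_map_bounded[OF _ cf] by auto
  obtain m where m: "prob {x \<in> space \<upsilon>. m < f x} \<le> 1 / 2" "prob {x \<in> space \<upsilon>. f x < m} \<le> 1 / 2"
    using median_exists[OF f] .
  have half: "ennreal (1 / 2) = 1 / 2"
    by (subst divide_ennreal[symmetric]) auto
  have "emeasure \<upsilon> {x \<in> mspace X. m < f x} \<le> 1 / 2"
    using m(1) unfolding sp emeasure_eq_measure half[symmetric] by (rule ennreal_leI)
  then obtain G where G[measurable]: "G \<in> borel_measurable \<upsilon>"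
    and G1: "cheeger_const (X, \<upsilon>) * (\<integral>\<^sup>+x. ennreal (max 0 (f x - m) powr p) \<partial>\<upsilon>) \<le> (\<integral>\<^sup>+x. G x \<partial>\<upsilon>)"
    and G2: "\<And>x. x \<in> mspace X \<Longrightarrow> G x \<le> ennreal (p * max 0 (f x - m) powr (p - 1) * Lip X f x)"
    using cheeger_const_pos_part_le[OF mm L p] by blast
  \<comment> \<open>The negative part of \<open>f - m\<close> is the positive part for
    \<open>- f\<close> and \<open>- m\<close>, and \<open>Lip\<close> ignores the sign.\<close>
  have "emeasure \<upsilon> {x \<in> mspace X. - m < - f x} \<le> 1 / 2"
    using m(2) unfolding sp emeasure_eq_measure half[symmetric] by (intro ennreal_leI) simp
  then obtain H where H[measurable]: "H \<in> borel_measurable \<upsilon>"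
    and H1: "cheeger_const (X, \<upsilon>) * (\<integral>\<^sup>+x. ennreal (max 0 (- f x - - m) powr p) \<partial>\<upsilon>) \<le> (\<integral>\<^sup>+x. H x \<partial>\<upsilon>)"
    and H2: "\<And>x. x \<in> mspace X \<Longrightarrow> H x \<le> ennreal (p * max 0 (- f x - - m) powr (p - 1) * Lip X (\<lambda>x. - f x) x)"
    using cheeger_const_pos_part_le[OF mm L(1) L' p] by blast
  define a where "a x = \<bar>f x - m\<bar>" for x
  have [measurable]: "a \<in> borel_measurable \<upsilon>" unfolding a_def[abs_def] by measurable
  \<comment> \<open>One summand is always \<open>0 powr q = 0\<close>, so this serves both
    \<open>p\<close> and \<open>p - 1\<close>.\<close>
  have split: "max 0 (f x - m) powr q + max 0 (- f x - - m) powr q = a x powr q" for x q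
    unfolding a_def by (cases "f x \<ge> m") (auto simp: max_def)
  define I where "I = (\<integral>x. a x powr p \<partial>\<upsilon>)"
  have "integrable \<upsilon> (\<lambda>x. a x powr p)"
  proof (rule compact_mm_space_integrable[OF mm, where B = "(C + \<bar>m\<bar>) powr p"])
    fix x assume "x \<in> mspace X"
    then have "a x \<le> C + \<bar>m\<bar>" using C[of x] by (auto simp: a_def)
    then show "\<bar>a x powr p\<bar> \<le> (C + \<bar>m\<bar>) powr p" using p by (auto simp: a_def intro!: powr_mono2)
  qed measurable
  then have I_eq: "(\<integral>\<^sup>+x. ennreal (a x powr p) \<partial>\<upsilon>) = ennreal I"
    unfolding I_def by (rule nn_integral_eq_integral) auto
  have I_ge: "1 \<le> I"
    using integral_abs_powr_shift_ge[OF mm p f C zero, of m] norm by (simp add: I_def a_def)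
  have hI: "cheeger_const (X, \<upsilon>) * ennreal I \<le> (\<integral>\<^sup>+x. G x + H x \<partial>\<upsilon>)"
  proof -
    have "cheeger_const (X, \<upsilon>) * ennreal I
        = cheeger_const (X, \<upsilon>) * (\<integral>\<^sup>+x. ennreal (max 0 (f x - m) powr p) + ennreal (max 0 (- f x - - m) powr p) \<partial>\<upsilon>)"
      unfolding I_eq[symmetric] split[symmetric] by (simp flip: ennreal_plus)
    also have "\<dots> \<le> (\<integral>\<^sup>+x. G x \<partial>\<upsilon>) + (\<integral>\<^sup>+x. H x \<partial>\<upsilon>)"
      using G1 H1 by (subst nn_integral_add) (auto simp: distrib_left intro: add_mono)
    also have "\<dots> = (\<integral>\<^sup>+x. G x + H x \<partial>\<upsilon>)" by (simp add: nn_integral_add)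
    finally show ?thesis .
  qed
  have GH: "G x + H x \<le> ennreal ((p - 1) * \<tau> * a x powr p) + ennreal (\<tau> powr (1 - p) * Lip X f x powr p)"
    if x: "x \<in> mspace X" for x
  proof -
    have l: "0 \<le> Lip X f x" by (rule Lip_nonneg[OF L(2) x])
    have "G x + H x \<le> ennreal (p * max 0 (f x - m) powr (p - 1) * Lip X f x)
        + ennreal (p * max 0 (- f x - - m) powr (p - 1) * Lip X f x)"
      using add_mono[OF G2[OF x] H2[OF x]] by (simp add: Lip_uminus)
    also have "\<dots> = ennreal (p * (max 0 (f x - m) powr (p - 1) + max 0 (- f x - - m) powr (p - 1)) * Lip X f x)"
      using p l by (subst ennreal_plus[symmetric]) (auto simp: algebra_simps)
    also have "\<dots> = ennreal (p * a x powr (p - 1) * Lip X f x)" by (simp only: split)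
    also have "\<dots> \<le> ennreal ((p - 1) * \<tau> * a x powr p + \<tau> powr (1 - p) * Lip X f x powr p)"
    proof (rule ennreal_leI)
      \<comment> \<open>Dividing by \<open>\<tau>\<close> before and multiplying by it after Young's
        inequality creates the weights \<open>(p - 1) * \<tau>\<close> and
        \<open>\<tau> powr (1 - p)\<close>.\<close>
      have "p * a x powr (p - 1) * (Lip X f x / \<tau>) \<le> (p - 1) * a x powr p + (Lip X f x / \<tau>) powr p"
        using p l \<tau> by (intro Youngs_inequality_powr) (auto simp: a_def)
      then have "\<tau> * (p * a x powr (p - 1) * (Lip X f x / \<tau>)) \<le> \<tau> * ((p - 1) * a x powr p + (Lip X f x / \<tau>) powr p)"
        using \<tau> by (intro mult_left_mono) auto
      then show "p * a x powr (p - 1) * Lip X f x \<le> (p - 1) * \<tau> * a x powr p + \<tau> powr (1 - p) * Lip X f x powr p"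
        using \<tau> l by (simp add: powr_divide powr_diff field_simps)
    qed
    finally show ?thesis using p \<tau> by (simp add: ennreal_plus)
  qed
  \<comment> \<open>\<open>Lip X f\<close> is not known to be measurable, so its upper integral may exceed the \<open>nn_integral\<close>;
    \<open>Q\<close> is a measurable function below the last summand in \<open>GH\<close>.\<close>
  define Q where "Q x = (G x + H x) - ennreal ((p - 1) * \<tau> * a x powr p)" for x
  have [measurable]: "Q \<in> borel_measurable \<upsilon>" unfolding Q_def[abs_def] by measurable
  \<comment> \<open>This factor cancels the weight \<open>\<tau> powr (1 - p)\<close> and leaves the
    energy of \<open>f\<close>, which is below \<open>\<tau> powr (p - 1) * \<tau>\<close>.\<close>
  have "ennreal (\<tau> powr (p - 1)) * (\<integral>\<^sup>+x. Q x \<partial>\<upsilon>) = (\<integral>\<^sup>+x. ennreal (\<tau> powr (p - 1)) * Q x \<partial>\<upsilon>)"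
    by (simp add: nn_integral_cmult)
  also have "\<dots> \<le> (\<integral>\<^sup>+x. ennreal (Lip X f x powr p) \<partial>\<upsilon>)"
  proof (rule nn_integral_mono)
    fix x assume "x \<in> space \<upsilon>"
    then have "Q x \<le> ennreal (\<tau> powr (1 - p) * Lip X f x powr p)"
      unfolding Q_def using GH[of x] by (intro ennreal_minus_le_iff[THEN iffD2]) (auto simp: sp add.commute)
    then have "ennreal (\<tau> powr (p - 1)) * Q x \<le> ennreal (\<tau> powr (p - 1)) * ennreal (\<tau> powr (1 - p) * Lip X f x powr p)"
      by (rule mult_left_mono) simp
    also have "\<dots> = ennreal ((\<tau> powr (p - 1) * \<tau> powr (1 - p)) * Lip X f x powr p)"
      by (simp add: ennreal_mult mult.assoc)
    also have "\<tau> powr (p - 1) * \<tau> powr (1 - p) = 1"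
      using \<tau> by (simp flip: powr_add)
    finally show "ennreal (\<tau> powr (p - 1)) * Q x \<le> ennreal (Lip X f x powr p)" by simp
  qed
  also have "\<dots> \<le> ennreal (\<tau> powr (p - 1)) * ennreal \<tau>"
    using less \<tau> powr_mult_base[of \<tau> "p - 1"] by (simp add: less_imp_le mult.commute flip: ennreal_mult)
  finally have Q_le: "(\<integral>\<^sup>+x. Q x \<partial>\<upsilon>) \<le> ennreal \<tau>"
    using \<tau> by (subst (asm) ennreal_mult_le_mult_iff) auto
  have "cheeger_const (X, \<upsilon>) * ennreal I \<le> (\<integral>\<^sup>+x. G x + H x \<partial>\<upsilon>)" by (rule hI)
  also have "\<dots> \<le> (\<integral>\<^sup>+x. Q x + ennreal ((p - 1) * \<tau>) * ennreal (a x powr p) \<partial>\<upsilon>)"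
  proof (rule nn_integral_mono)
    fix x
    have "G x + H x \<le> ennreal ((p - 1) * \<tau> * a x powr p) + Q x"
      using ennreal_minus_le_iff[THEN iffD1, OF order_refl] unfolding Q_def by blast
    then show "G x + H x \<le> Q x + ennreal ((p - 1) * \<tau>) * ennreal (a x powr p)"
      using p \<tau> by (simp add: ennreal_mult add.commute)
  qed
  also have "\<dots> = (\<integral>\<^sup>+x. Q x \<partial>\<upsilon>) + ennreal ((p - 1) * \<tau>) * ennreal I"
    by (simp add: nn_integral_add nn_integral_cmult I_eq)
  also have "\<dots> \<le> ennreal \<tau> + ennreal ((p - 1) * \<tau>) * ennreal I"
    using Q_le by (rule add_right_mono)
  also have "\<dots> = ennreal (\<tau> + (p - 1) * \<tau> * I)"
    using p \<tau> I_ge by (simp add: ennreal_mult ennreal_plus)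
  \<comment> \<open>\<open>1 \<le> I\<close> enlarges the lone \<open>\<tau>\<close> to
    \<open>\<tau> * I\<close>; then \<open>I\<close>, finite and positive, cancels.\<close>
  also have "\<dots> \<le> ennreal (p * \<tau> * I)"
    using mult_left_mono[OF I_ge, of \<tau>] \<tau> by (intro ennreal_leI) (simp add: algebra_simps)
  also have "\<dots> = ennreal (p * \<tau>) * ennreal I"
    using p \<tau> I_ge by (simp add: ennreal_mult)
  finally have "ennreal I * cheeger_const (X, \<upsilon>) \<le> ennreal I * ennreal (p * \<tau>)"
    by (simp add: mult.commute)
  then show ?thesis
    using I_ge by (subst (asm) ennreal_mult_le_mult_iff) auto
qed

text \<open>The infimum need not be attained, so test functions with energy slightly above it are
  used and the excess tends to 0.\<close>

lemma cheeger_const_le_lambda1: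
  assumes mm: "compact_mm_space (X, \<upsilon>)" and p: "1 < p"
  shows "cheeger_const (X, \<upsilon>) \<le> ennreal p * ennreal_powr (lambda1 p (X, \<upsilon>)) (1 / p)"
proof (cases "lambda1 p (X, \<upsilon>)")
  \<comment> \<open>This includes the case of no admissible function.\<close>
  case top
  then show ?thesis using p by (simp add: ennreal_powr_def ennreal_mult_top)
next
  case (real l)
  have "cheeger_const (X, \<upsilon>) \<le> ennreal (p * (l powr (1 / p) + e))" if e: "0 < e" for e
  proof -
    \<comment> \<open>The summand \<open>e\<close> leaves room for a test function with energy below
      \<open>\<tau> powr p\<close>, and keeps \<open>\<tau>\<close> positive when
      \<open>l = 0\<close>.\<close>
    define \<tau> where "\<tau> = l powr (1 / p) + e"
    have \<tau>: "0 < \<tau>" using e by (simp add: \<tau>_def add_nonneg_pos)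
    have "l = (l powr (1 / p)) powr p" using p real(1) by (simp add: powr_powr)
    also have "\<dots> < \<tau> powr p" using p e by (intro powr_less_mono2) (auto simp: \<tau>_def)
    finally have "lambda1 p (X, \<upsilon>) < ennreal (\<tau> powr p)"
      using real(1) unfolding real(2) by (intro ennreal_lessI) auto
    then obtain f where "Lipschitz_continuous_map X euclidean_metric f"
      "(\<integral>x. \<bar>f x\<bar> powr p \<partial>\<upsilon>) = 1" "(\<integral>x. \<bar>f x\<bar> powr (p - 2) * f x \<partial>\<upsilon>) = 0"
      "(\<integral>\<^sup>+x. ennreal (Lip X f x powr p) \<partial>\<upsilon>) < ennreal (\<tau> powr p)"
      unfolding lambda1_def by (auto simp: INF_less_iff)
    from cheeger_const_le_of_Lip_integral_less[OF mm p \<tau> this] show ?thesis by (simp add: \<tau>_def)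
  qed
  note bound = this
  have "cheeger_const (X, \<upsilon>) \<le> ennreal (p * l powr (1 / p))"
  proof (rule ennreal_le_epsilon)
    fix e :: real assume "0 < e"
    then have "cheeger_const (X, \<upsilon>) \<le> ennreal (p * (l powr (1 / p) + e / p))"
      using p by (intro bound) auto
    also have "p * (l powr (1 / p) + e / p) = p * l powr (1 / p) + e"
      using p by (simp add: field_simps)
    finally show "cheeger_const (X, \<upsilon>) \<le> ennreal (p * l powr (1 / p)) + ennreal e"
      using p \<open>0 < e\<close> by (simp add: ennreal_plus)
  qed
  also have "\<dots> = ennreal p * ennreal_powr (lambda1 p (X, \<upsilon>)) (1 / p)"
    using p real by (simp add: ennreal_powr_def ennreal_mult)
  finally show ?thesis .
qed

text \<open>Membership in \<open>mGH_limits\<close> includes \<open>compact_mm_space\<close>, so the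
  inequality for compact metric measure spaces applies.\<close>

theorem mainTheorem5:
  fixes K d p :: real
    and X :: "'a metric" and \<upsilon> :: "'a measure"
  assumes "d > 0"
    and "1 < p"
    and "(X, \<upsilon>) \<in> mGH_limits (ricci_class TYPE('n::finite) K d :: ('m metric \<times> 'm measure) set)"
  shows "cheeger_const (X, \<upsilon>) \<le> ennreal p * ennreal_powr (lambda1 p (X, \<upsilon>)) (1 / p)"
  using assms cheeger_const_le_lambda1 by (auto simp: mGH_limits_def)

end
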